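(* Let $k\ge 4$ be an integer, let $X$ be large, let $1<d<X^{1/(3(k+1))}$, and let $\chi$ be a primitive (nonprincipal) Dirichlet character modulo $d$. Then $$\sum_{n\le X}\tau_k(n)\chi(n)\ll X^{1-\frac{1}{3(k+2)}},$$ with implied constant depending at most on $k$.
   Context: $\tau_k(n)$ is the $k$-fold divisor function (number of ordered factorizations $n=n_1\cdots n_k$ into positive integers). *)

theory Defs
  imports Complex_Main
begin

text \<open>
  For \<open>n > 0\<close> all factors in a factorization are automatically positive. (For \<open>n = 0\<close> the value
  carries no meaning.)
\<close>
definition divisor_tau :: "nat \<Rightarrow> nat \<Rightarrow> nat" where
  "divisor_tau k n = card {ns :: nat list. length ns = k \<and> prod_list ns = n}"

definition dirichlet_character :: "nat \<Rightarrow> (nat \<Rightarrow> complex) \<Rightarrow> bool" where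
  "dirichlet_character d \<chi> \<longleftrightarrow>
     d > 0 \<and>
     (\<forall>m n. \<chi> (m * n) = \<chi> m * \<chi> n) \<and>
     (\<forall>n. \<chi> (n + d) = \<chi> n) \<and>
     (\<forall>n. \<chi> n \<noteq> 0 \<longleftrightarrow> coprime n d)"

definition principal_character :: "nat \<Rightarrow> nat \<Rightarrow> complex" where
  "principal_character d n = (if coprime n d then 1 else 0)"

definition induced_by ::
    "nat \<Rightarrow> (nat \<Rightarrow> complex) \<Rightarrow> nat \<Rightarrow> (nat \<Rightarrow> complex) \<Rightarrow> bool" where
  "induced_by d \<chi> d' \<chi>' \<longleftrightarrow>
     d' dvd d \<and> dirichlet_character d' \<chi>' \<and> (\<forall>n. coprime n d \<longrightarrow> \<chi> n = \<chi>' n)"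

definition primitive_character :: "nat \<Rightarrow> (nat \<Rightarrow> complex) \<Rightarrow> bool" where
  "primitive_character d \<chi> \<longleftrightarrow>
     dirichlet_character d \<chi> \<and> \<not> (\<exists>d' \<chi>'. d' < d \<and> induced_by d \<chi> d' \<chi>')"

lemma primitive_character_nonprincipal:
  assumes "primitive_character d \<chi>" and "d > 1"
  shows "\<chi> \<noteq> principal_character d"
proof
  assume "\<chi> = principal_character d"
  hence "induced_by d \<chi> 1 (\<lambda>_. 1)"
    by (simp add: induced_by_def dirichlet_character_def principal_character_def)
  thus False
    using assms unfolding primitive_character_def by blast
qed

end

theory Submission
  imports Defs "HOL-Number_Theory.Cong"
begin

text \<open>
  By periodicity a nonprincipal character modulo \<open>d\<close> has sums of size \<open>O(d)\<close> over intervals.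
  Splitting \<open>n = a b\<close> with \<open>b\<close> weighted by \<open>\<tau>\<^sub>k\<close> gives a hyperbola method: for
  \<open>a \<le> N\<^bsup>1/(k+1)\<^esup>\<close> one sums over \<open>b\<close> first and uses the bound for \<open>\<tau>\<^sub>k\<close>, and for larger \<open>a\<close>
  one sums over \<open>a\<close> first and uses the character sum bound. By induction this yields
  \<open>O(d N\<^bsup>1 - 2/(3k)\<^esup>)\<close> (in truth \<open>1 - 1/k\<close> up to logarithms), and
  \<open>2/(3k) > 1/(3(k+1)) + 1/(3(k+2))\<close>, so the range of \<open>d\<close> is more than sufficient.
\<close>

section \<open>Character sums over intervals\<close>

lemma dirichlet_character_mod:
  assumes "dirichlet_character d \<chi>"
  shows "\<chi> (n mod d) = \<chi> n"
proof -
  have "\<chi> (m + d * q) = \<chi> m" for m q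
  proof (induction q)
    case (Suc q)
    have "\<chi> (m + d * q + d) = \<chi> (m + d * q)"
      using assms unfolding dirichlet_character_def by blast
    then show ?case
      using Suc by (simp add: algebra_simps)
  qed simp
  from this[of "n mod d" "n div d"] show ?thesis
    by simp
qed

lemma dirichlet_character_1:
  assumes "dirichlet_character d \<chi>"
  shows "\<chi> 1 = 1"
proof -
  have "\<chi> (1 * 1) = \<chi> 1 * \<chi> 1" "\<chi> 1 \<noteq> 0"
    using assms unfolding dirichlet_character_def by (blast, simp)
  then show ?thesis
    by simp
qed

text \<open>The powers of \<open>\<chi> n\<close> are the values of \<open>\<chi>\<close> at
  \<open>n ^ j\<close>. Periodicity leaves only finitely many values, so these powers are bounded,
  whereas a number of norm above 1 has unbounded powers.\<close>

lemma norm_dirichlet_character_le_1: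
  assumes "dirichlet_character d \<chi>"
  shows "norm (\<chi> n) \<le> 1"
proof (rule ccontr)
  assume "\<not> norm (\<chi> n) \<le> 1"
  then have gt: "norm (\<chi> n) > 1"
    by simp
  have pos: "d > 0"
    using assms by (simp add: dirichlet_character_def)
  define M where "M = Max ((\<lambda>i. norm (\<chi> i)) ` {..<d})"
  have bounded: "norm (\<chi> i) \<le> M" for i
  proof -
    have "norm (\<chi> (i mod d)) \<le> M"
      unfolding M_def using pos by (intro Max_ge) auto
    then show ?thesis
      by (simp add: dirichlet_character_mod[OF assms])
  qed
  have pow: "\<chi> (n ^ j) = \<chi> n ^ j" for j
  proof (induction j)
    case 0
    then show ?case
      using dirichlet_character_1[OF assms] by simp
  next
    case (Suc j)
    then show ?case
      using assms by (simp add: dirichlet_character_def)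
  qed
  obtain j where "M < norm (\<chi> n) ^ j"
    using real_arch_pow[OF gt] by blast
  with bounded[of "n ^ j"] show False
    by (simp add: pow norm_power)
qed

text \<open>Multiplication by a unit \<open>a\<close> permutes the residues, so the sum S over a
  period satisfies S = \<open>\<chi> a\<close> * S. A nonprincipal character has a unit with
  \<open>\<chi> a\<close> different from 1, which forces S = 0.\<close>

lemma sum_dirichlet_character_period:
  assumes \<chi>: "dirichlet_character d \<chi>" and np: "\<chi> \<noteq> principal_character d"
  shows "(\<Sum>n<d. \<chi> n) = 0"
proof -
  obtain a where "\<chi> a \<noteq> principal_character d a"
    using np by blast
  \<comment> \<open>At arguments not coprime to \<open>d\<close> both characters vanish, so they can
    only differ at a unit, where the principal value is 1.\<close>
  then have a: "coprime a d" "\<chi> a \<noteq> 1"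
    using \<chi> by (auto simp: principal_character_def dirichlet_character_def split: if_splits)
  have pos: "d > 0"
    using \<chi> by (simp add: dirichlet_character_def)
  have inj: "inj_on (\<lambda>n. a * n mod d) {..<d}"
  proof (rule inj_onI)
    fix x y assume xy: "x \<in> {..<d}" "y \<in> {..<d}" "a * x mod d = a * y mod d"
    then have "[a * x = a * y] (mod d)"
      by (simp add: cong_def)
    then have "[x = y] (mod d)"
      using a(1) by (simp add: cong_mult_lcancel_nat)
    then show "x = y"
      using xy by (simp add: cong_def)
  qed
  have "(\<lambda>n. a * n mod d) ` {..<d} = {..<d}"
    by (rule endo_inj_surj) (use inj pos in auto)
  then have "(\<Sum>n<d. \<chi> n) = (\<Sum>n<d. \<chi> (a * n mod d))"
    using inj by (intro sum.reindex_cong[of "\<lambda>n. a * n mod d"]) auto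
  also have "\<dots> = \<chi> a * (\<Sum>n<d. \<chi> n)"
    using \<chi> by (simp add: dirichlet_character_mod[OF \<chi>] sum_distrib_left dirichlet_character_def)
  finally show ?thesis
    using a(2) by simp
qed

text \<open>Full periods cancel and can be stripped off one at a time. What remains has fewer than
  \<open>d\<close> terms, each of norm at most 1.\<close>

lemma norm_sum_dirichlet_character_lessThan:
  assumes \<chi>: "dirichlet_character d \<chi>" and np: "\<chi> \<noteq> principal_character d"
  shows "norm (\<Sum>n<N. \<chi> n) \<le> real d"
proof (induction N rule: less_induct)
  case (less N)
  have pos: "d > 0"
    using \<chi> by (simp add: dirichlet_character_def)
  show ?case
  proof (cases "N < d")
    case True
    have "norm (\<Sum>n<N. \<chi> n) \<le> (\<Sum>n<N. 1)"
      by (intro sum_norm_le norm_dirichlet_character_le_1[OF \<chi>])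
    then show ?thesis
      using True by simp
  next
    case False
    then have N: "N = d + (N - d)"
      by simp
    have "(\<Sum>n<N. \<chi> n) = (\<Sum>n<d. \<chi> n) + (\<Sum>n<N - d. \<chi> (d + n))"
      by (subst N, subst lessThan_atLeast0, subst sum.atLeastLessThan_concat[of 0 d, symmetric])
        (use sum.shift_bounds_nat_ivl[of \<chi> 0 d "N - d"] in
          \<open>auto simp: lessThan_atLeast0 add.commute\<close>)
    also have "\<dots> = (\<Sum>n<N - d. \<chi> n)"
      using \<chi> by (simp add: sum_dirichlet_character_period[OF assms] dirichlet_character_def
          add.commute[of d])
    finally show ?thesis
      using less[of "N - d"] pos False by simp
  qed
qed

lemma norm_sum_dirichlet_character_interval:
  assumes "dirichlet_character d \<chi>" and "\<chi> \<noteq> principal_character d"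
  shows "norm (\<Sum>n\<in>{A<..B}. \<chi> n) \<le> 2 * real d"
proof (cases "A \<le> B")
  case True
  have "{..<Suc B} = {..<Suc A} \<union> {A<..B}"
    using True by auto
  then have "(\<Sum>n<Suc B. \<chi> n) = (\<Sum>n<Suc A. \<chi> n) + (\<Sum>n\<in>{A<..B}. \<chi> n)"
    by (metis (no_types, lifting) finite_greaterThanAtMost finite_lessThan sum.union_disjoint
        disjoint_iff greaterThanAtMost_iff lessThan_iff less_Suc_eq_le not_le)
  then have "(\<Sum>n\<in>{A<..B}. \<chi> n) = (\<Sum>n<Suc B. \<chi> n) - (\<Sum>n<Suc A. \<chi> n)"
    by simp
  then have "norm (\<Sum>n\<in>{A<..B}. \<chi> n) \<le> norm (\<Sum>n<Suc B. \<chi> n) + norm (\<Sum>n<Suc A. \<chi> n)"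
    by (metis norm_triangle_ineq4)
  also have "\<dots> \<le> real d + real d"
    by (intro add_mono norm_sum_dirichlet_character_lessThan assms)
  finally show ?thesis
    by simp
qed simp

section \<open>Sums of the divisor functions\<close>

text \<open>The ring is left general because two instances are needed: the complex sum twisted by
  \<open>\<chi>\<close>, and the real sum with constant weight 1 that bounds the absolute
  values.\<close>

definition tau_sum :: "(nat \<Rightarrow> 'a::comm_ring_1) \<Rightarrow> nat \<Rightarrow> nat \<Rightarrow> 'a" where
  "tau_sum g k N = (\<Sum>n=1..N. of_nat (divisor_tau k n) * g n)"

text \<open>The lower bound 1 on the product excludes zero entries, which would otherwise allow
  infinitely many lists.\<close>

definition factor_lists :: "nat \<Rightarrow> nat \<Rightarrow> nat list set" where
  "factor_lists k N = {ns. length ns = k \<and> prod_list ns \<in> {1..N}}"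

text \<open>Split off the head \<open>a\<close>: for positive \<open>a\<close>, a tail with product
  p fits exactly when p is at most \<open>N div a\<close>.\<close>

lemma factor_lists_Suc:
  "factor_lists (Suc k) N = (\<lambda>(a, ns). a # ns) ` (SIGMA a:{1..N}. factor_lists k (N div a))"
proof (intro equalityI subsetI)
  fix ns assume ns: "ns \<in> factor_lists (Suc k) N"
  then obtain a ms where eq: "ns = a # ms"
    by (auto simp: factor_lists_def length_Suc_conv)
  from ns eq have *: "length ms = k" "1 \<le> a * prod_list ms" "a * prod_list ms \<le> N"
    by (auto simp: factor_lists_def)
  then have pos: "a > 0" "prod_list ms > 0"
    by (auto intro: Nat.gr0I)
  have "a \<le> a * prod_list ms"
    using pos by simp
  then have "a \<le> N"
    using * by linarith
  moreover have "prod_list ms \<le> N div a"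
    using * pos by (simp add: less_eq_div_iff_mult_less_eq mult.commute)
  ultimately show "ns \<in> (\<lambda>(a, ns). a # ns) ` (SIGMA a:{1..N}. factor_lists k (N div a))"
    using eq pos * by (force simp: factor_lists_def)
next
  fix ns assume "ns \<in> (\<lambda>(a, ns). a # ns) ` (SIGMA a:{1..N}. factor_lists k (N div a))"
  then obtain a ms where *: "ns = a # ms" "1 \<le> a" "length ms = k" "1 \<le> prod_list ms"
    "prod_list ms \<le> N div a"
    by (auto simp: factor_lists_def)
  then have "a * prod_list ms \<le> N"
    by (simp add: less_eq_div_iff_mult_less_eq mult.commute)
  moreover have "1 \<le> a * prod_list ms"
    using * by simp
  ultimately show "ns \<in> factor_lists (Suc k) N"
    using * by (simp add: factor_lists_def)
qed

lemma finite_factor_lists: "finite (factor_lists k N)"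
proof (induction k arbitrary: N)
  case 0
  have "factor_lists 0 N \<subseteq> {[]}"
    by (auto simp: factor_lists_def)
  then show ?case
    by (rule finite_subset) simp
next
  case (Suc k)
  then show ?case
    by (auto simp: factor_lists_Suc)
qed

lemma tau_sum_factor_lists: "tau_sum g k N = (\<Sum>ns\<in>factor_lists k N. g (prod_list ns))"
proof -
  have "(\<Sum>ns\<in>factor_lists k N. g (prod_list ns)) =
        (\<Sum>n=1..N. \<Sum>ns\<in>{ns \<in> factor_lists k N. prod_list ns = n}. g (prod_list ns))"
    by (rule sum.group[symmetric]) (auto simp: finite_factor_lists, auto simp: factor_lists_def)
  also have "\<dots> = (\<Sum>n=1..N. of_nat (divisor_tau k n) * g n)"
  proof (rule sum.cong[OF refl])
    fix n assume n: "n \<in> {1..N}"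
    then have "{ns \<in> factor_lists k N. prod_list ns = n} =
        {ns. length ns = k \<and> prod_list ns = n}"
      by (auto simp: factor_lists_def)
    then show "(\<Sum>ns\<in>{ns \<in> factor_lists k N. prod_list ns = n}. g (prod_list ns)) =
        of_nat (divisor_tau k n) * g n"
      by (simp add: divisor_tau_def)
  qed
  finally show ?thesis
    by (simp add: tau_sum_def)
qed

text \<open>This is the summed form of the Dirichlet convolution of \<tau>_k with 1; complete
  multiplicativity lets \<open>g a\<close> leave the inner sum.\<close>

lemma tau_sum_Suc:
  assumes mult: "\<And>m n. g (m * n) = g m * g n"
  shows "tau_sum g (Suc k) N = (\<Sum>a=1..N. g a * tau_sum g k (N div a))"
proof -
  have inj: "inj_on (\<lambda>(a, ns). a # ns) (SIGMA a:{1..N}. factor_lists k (N div a))"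
    by (auto simp: inj_on_def)
  have "tau_sum g (Suc k) N =
      (\<Sum>(a, ns)\<in>(SIGMA a:{1..N}. factor_lists k (N div a)). g a * g (prod_list ns))"
    unfolding tau_sum_factor_lists factor_lists_Suc sum.reindex[OF inj]
    by (simp add: case_prod_unfold mult)
  also have "\<dots> = (\<Sum>a=1..N. g a * tau_sum g k (N div a))"
    by (simp add: tau_sum_factor_lists sum_distrib_left sum.Sigma finite_factor_lists)
  finally show ?thesis .
qed

lemma tau_sum_0: "tau_sum g 0 N = (if N \<ge> 1 then g 1 else 0)"
proof -
  have "factor_lists 0 N = (if N \<ge> 1 then {[]} else {})"
    by (auto simp: factor_lists_def)
  then show ?thesis
    by (simp add: tau_sum_factor_lists)
qed

lemma tau_sum_1: "tau_sum g 1 N = (\<Sum>n=1..N. g n)"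
proof -
  have "{ns :: nat list. length ns = Suc 0 \<and> prod_list ns = n} = {[n]}" for n
    by (auto simp: length_Suc_conv)
  then show ?thesis
    by (simp add: tau_sum_def divisor_tau_def)
qed

text \<open>The sum runs over pairs with \<open>a * b \<le> N\<close>. Pairs with
  \<open>a \<le> A\<close> keep \<open>b\<close> as the inner variable; for the others the order is
  swapped, so that the inner sum is a pure sum of \<open>g\<close> over an interval. That interval
  is empty once \<open>N div b \<le> A\<close>.\<close>

lemma tau_sum_hyperbola:
  assumes mult: "\<And>m n. g (m * n) = g m * g n" and A: "A \<le> N"
  shows "tau_sum g (Suc k) N = (\<Sum>a=1..A. g a * tau_sum g k (N div a)) +
      (\<Sum>b=1..N. of_nat (divisor_tau k b) * g b * (\<Sum>a\<in>{A<..N div b}. g a))"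
proof -
  define w where "w b = of_nat (divisor_tau k b) * g b" for b
  have "{1..N} = {1..A} \<union> {A<..N}"
    using A by auto
  then have "tau_sum g (Suc k) N = (\<Sum>a=1..A. g a * tau_sum g k (N div a)) +
      (\<Sum>a\<in>{A<..N}. g a * tau_sum g k (N div a))"
    unfolding tau_sum_Suc[of g, OF mult] by (simp add: sum.union_disjoint ivl_disj_int)
  also have "(\<Sum>a\<in>{A<..N}. g a * tau_sum g k (N div a)) =
      (\<Sum>a\<in>{A<..N}. \<Sum>b\<in>{b\<in>{1..N}. a * b \<le> N}. g a * w b)"
  proof (rule sum.cong[OF refl])
    fix a assume a: "a \<in> {A<..N}"
    have "b \<le> N" if "a * b \<le> N" for b
      using that a by (cases a) auto
    then have "{1..N div a} = {b\<in>{1..N}. a * b \<le> N}"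
      using a by (auto simp: less_eq_div_iff_mult_less_eq mult.commute)
    then show "g a * tau_sum g k (N div a) = (\<Sum>b\<in>{b\<in>{1..N}. a * b \<le> N}. g a * w b)"
      unfolding tau_sum_def w_def by (simp add: sum_distrib_left)
  qed
  also have "\<dots> = (\<Sum>b=1..N. \<Sum>a\<in>{a\<in>{A<..N}. a * b \<le> N}. g a * w b)"
    by (rule sum.swap_restrict) auto
  also have "\<dots> = (\<Sum>b=1..N. w b * (\<Sum>a\<in>{A<..N div b}. g a))"
  proof (rule sum.cong[OF refl])
    fix b assume b: "b \<in> {1..N}"
    have "a \<le> N" if "a * b \<le> N" for a
      using that b by (cases b) auto
    then have "{a\<in>{A<..N}. a * b \<le> N} = {A<..N div b}"
      using b by (auto simp: less_eq_div_iff_mult_less_eq)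
    then show "(\<Sum>a\<in>{a\<in>{A<..N}. a * b \<le> N}. g a * w b) = w b * (\<Sum>a\<in>{A<..N div b}. g a)"
      by (simp add: sum_distrib_left mult.commute)
  qed
  finally show ?thesis
    by (simp add: w_def)
qed

section \<open>Power bounds for the untwisted divisor sums\<close>

lemma sum_powr_le:
  fixes \<beta> :: real
  assumes "0 < \<beta>" "\<beta> < 1"
  shows "(\<Sum>a=1..A. real a powr (\<beta> - 1)) \<le> real A powr \<beta> / \<beta>"
proof (induction A)
  case (Suc A)
  \<comment> \<open>Each term is compared with an increment of x^\<beta>, the antiderivative of
    \<beta> x^(\<beta>-1), so that the sum telescopes.\<close>
  have "\<beta> * real (Suc A) powr (\<beta> - 1) \<le> real (Suc A) powr \<beta> - real A powr \<beta>"
  proof (cases "A = 0")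
    case False
    have "\<exists>z>real A. z < real (Suc A) \<and> real (Suc A) powr \<beta> - real A powr \<beta> =
        (real (Suc A) - real A) * (\<beta> * z powr (\<beta> - 1))"
      using False by (intro MVT2) (auto intro!: derivative_eq_intros)
    then obtain z where z: "real A < z" "z < real (Suc A)"
      "real (Suc A) powr \<beta> - real A powr \<beta> = \<beta> * z powr (\<beta> - 1)"
      by auto
    have "real (Suc A) powr (\<beta> - 1) \<le> z powr (\<beta> - 1)"
      using z assms by (intro powr_mono2') auto
    then show ?thesis
      using z(3) assms by simp
  qed (use assms in simp)
  then have "real (Suc A) powr (\<beta> - 1) \<le> (real (Suc A) powr \<beta> - real A powr \<beta>) / \<beta>"
    using assms by (simp add: field_simps)
  then show ?case
    using Suc by (simp add: diff_divide_distrib)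
qed simp

text \<open>Each new factor would cost a logarithm, namely the sum of 1/a. Replacing 1/a by the
  larger a^(\<beta>-1) costs N^\<beta> / \<beta> instead, which keeps every bound a pure power;
  \<beta> stays free, so the total loss can be made as small as desired.\<close>

lemma tau_sum_const_1_le_powr:
  assumes \<beta>: "0 < \<beta>" "\<beta> < 1"
  shows "tau_sum (\<lambda>_. 1 :: real) k N \<le> (1 / \<beta>) ^ k * real N powr (1 + real k * \<beta>)"
proof (induction k arbitrary: N)
  case 0
  show ?case
    by (simp add: tau_sum_0)
next
  case (Suc k)
  define B where "B = (1 / \<beta>) ^ k * real N powr (1 + real k * \<beta>)"
  have B: "B \<ge> 0"
    using \<beta> by (simp add: B_def)
  have "tau_sum (\<lambda>_. 1 :: real) (Suc k) N = (\<Sum>a=1..N. tau_sum (\<lambda>_. 1) k (N div a))"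
    by (subst tau_sum_Suc) auto
  also have "\<dots> \<le> (\<Sum>a=1..N. B * real a powr (\<beta> - 1))"
  proof (rule sum_mono)
    fix a assume a: "a \<in> {1..N}"
    have "tau_sum (\<lambda>_. 1) k (N div a) \<le> (1 / \<beta>) ^ k * real (N div a) powr (1 + real k * \<beta>)"
      by (rule Suc.IH)
    also have "\<dots> \<le> (1 / \<beta>) ^ k * (real N / real a) powr (1 + real k * \<beta>)"
      using \<beta> by (intro mult_left_mono powr_mono2 of_nat_div_le_of_nat) auto
    also have "\<dots> = B * real a powr (- (1 + real k * \<beta>))"
      unfolding B_def powr_minus_divide by (simp add: powr_divide)
    also have "\<dots> \<le> B * real a powr (\<beta> - 1)"
    proof (intro mult_left_mono powr_mono B)
      have "0 \<le> real k * \<beta>"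
        using \<beta> by simp
      then show "- (1 + real k * \<beta>) \<le> \<beta> - 1"
        using \<beta> by linarith
    qed (use a in auto)
    finally show "tau_sum (\<lambda>_. 1) k (N div a) \<le> B * real a powr (\<beta> - 1)" .
  qed
  also have "\<dots> = B * (\<Sum>a=1..N. real a powr (\<beta> - 1))"
    by (simp add: sum_distrib_left)
  also have "\<dots> \<le> B * (real N powr \<beta> / \<beta>)"
    by (intro mult_left_mono sum_powr_le \<beta> B)
  also have "\<dots> = (1 / \<beta>) ^ Suc k * (real N powr (1 + real k * \<beta>) * real N powr \<beta>)"
    by (simp add: B_def)
  also have "\<dots> = (1 / \<beta>) ^ Suc k * real N powr (1 + real (Suc k) * \<beta>)"
    unfolding powr_add[symmetric] by (simp add: algebra_simps)
  finally show ?case .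
qed

section \<open>Divisor sums twisted by a character\<close>

text \<open>The induction step, with explicit constants to show that nothing depends on
  \<open>d\<close>, \<open>\<chi>\<close> or \<open>N\<close>. The factor
  \<open>3 * real k / 2\<close> is 1/\<beta> from summing a^(\<beta>-1); the 8 is 2 from the
  interval bound times 4 from rounding the cut \<open>A\<close>.\<close>

lemma norm_tau_sum_character_step:
  assumes k: "k \<ge> 1" and C: "C \<ge> 0" and B: "B \<ge> 0"
    and \<chi>: "dirichlet_character d \<chi>" and np: "\<chi> \<noteq> principal_character d"
    and IH: "\<And>N. N \<ge> 1 \<Longrightarrow> norm (tau_sum \<chi> k N) \<le> C * real d * real N powr (1 - 2 / (3 * real k))"
    and bound: "\<And>N. tau_sum (\<lambda>_. 1) k N \<le> B * real N powr (1 + 1 / (3 * (real k + 1)))"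
    and N: "N \<ge> 1"
  shows "norm (tau_sum \<chi> (Suc k) N) \<le>
      (C * (3 * real k / 2) + 8 * B) * real d * real N powr (1 - 2 / (3 * (real k + 1)))"
proof -
  \<comment> \<open>Here \<alpha> fixes the cut at N^\<alpha>, \<beta> is the saving in the
    induction hypothesis, \<delta> the loss in the bound for the untwisted sum, and \<gamma> the
    target exponent.\<close>
  define \<alpha> where "\<alpha> = 1 / (real k + 1)"
  define \<beta> where "\<beta> = 2 / (3 * real k)"
  define \<delta> where "\<delta> = 1 / (3 * (real k + 1))"
  define \<gamma> where "\<gamma> = 1 - 2 / (3 * (real k + 1))"
  define A where "A = nat \<lfloor>real N powr \<alpha>\<rfloor>"
  have \<alpha>: "0 < \<alpha>" "\<alpha> \<le> 1" and \<beta>: "0 < \<beta>" "\<beta> < 1" and \<delta>: "0 < \<delta>" "\<delta> \<le> 1"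
    using k by (auto simp: \<alpha>_def \<beta>_def \<delta>_def field_simps)
  \<comment> \<open>Exponent of the part with small \<open>a\<close>, where N^(1-\<beta>) A^\<beta>
    arises: the target is met exactly.\<close>
  have e1: "1 - \<beta> + \<alpha> * \<beta> = \<gamma>"
  proof -
    have "1 - \<alpha> = real k / (real k + 1)"
      by (simp add: \<alpha>_def field_simps)
    then have "\<beta> * (1 - \<alpha>) = 1 - \<gamma>"
      using k by (simp add: \<beta>_def \<gamma>_def)
    then show ?thesis
      by (simp add: algebra_simps)
  qed
  \<comment> \<open>Exponent of the part with large \<open>a\<close>, where (N/A)^(1+\<delta>)
    arises. As \<alpha> = 3\<delta> and \<gamma> = 1 - 2\<delta>, the loss \<delta> is just
    affordable.\<close>
  have e2: "(1 - \<alpha>) * (1 + \<delta>) \<le> \<gamma>"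
  proof -
    have "(1 - \<alpha>) * (1 + \<delta>) = 1 - \<alpha> + \<delta> - \<alpha> * \<delta>"
      by (simp add: algebra_simps)
    also have "\<dots> \<le> 1 - \<alpha> + \<delta>"
      using \<alpha> \<delta> by simp
    also have "\<dots> = \<gamma>"
    proof -
      have "\<alpha> = 3 * \<delta>" "\<gamma> = 1 - 2 * \<delta>"
        by (simp_all add: \<alpha>_def \<delta>_def \<gamma>_def divide_simps)
      then show ?thesis
        by simp
    qed
    finally show ?thesis .
  qed
  have mult: "\<chi> (m * n) = \<chi> m * \<chi> n" for m n
    using \<chi> by (simp add: dirichlet_character_def)
  have root: "1 \<le> real N powr \<alpha>" "real N powr \<alpha> \<le> real N"
    using N \<alpha> powr_mono[of \<alpha> 1 "real N"] by (auto simp: ge_one_powr_ge_zero)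
  have A1: "A \<ge> 1"
    using root by (simp add: A_def le_nat_iff)
  have A_le: "real A \<le> real N powr \<alpha>" and A_gt: "real N powr \<alpha> < real A + 1"
    using root unfolding A_def by linarith+
  have AN: "A \<le> N"
    using A_le root by linarith
  \<comment> \<open>Rounding down a number that is at least 1 loses at most a factor 2.\<close>
  have A_ge: "real N powr \<alpha> / 2 \<le> real A"
    using A_gt A1 by simp

  have "norm (\<Sum>a=1..A. \<chi> a * tau_sum \<chi> k (N div a)) \<le>
      (\<Sum>a=1..A. C * real d * (real N powr (1 - \<beta>) * real a powr (\<beta> - 1)))"
  proof (rule sum_norm_le)
    fix a assume a: "a \<in> {1..A}"
    then have "N div a \<ge> 1"
      using AN by (simp add: less_eq_div_iff_mult_less_eq)
    have "norm (\<chi> a * tau_sum \<chi> k (N div a)) \<le> 1 * norm (tau_sum \<chi> k (N div a))"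
      unfolding norm_mult by (intro mult_right_mono norm_dirichlet_character_le_1[OF \<chi>]) auto
    also have "\<dots> \<le> C * real d * real (N div a) powr (1 - \<beta>)"
      using IH[OF \<open>N div a \<ge> 1\<close>] by (simp add: \<beta>_def)
    also have "\<dots> \<le> C * real d * (real N / real a) powr (1 - \<beta>)"
      using C \<beta> by (intro mult_left_mono powr_mono2 of_nat_div_le_of_nat) auto
    also have "(real N / real a) powr (1 - \<beta>) = real N powr (1 - \<beta>) * real a powr (\<beta> - 1)"
      using powr_minus_divide[of "real a" "1 - \<beta>"] by (simp add: powr_divide)
    finally show "norm (\<chi> a * tau_sum \<chi> k (N div a)) \<le>
        C * real d * (real N powr (1 - \<beta>) * real a powr (\<beta> - 1))" .
  qed
  also have "\<dots> = C * real d * real N powr (1 - \<beta>) * (\<Sum>a=1..A. real a powr (\<beta> - 1))"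
    by (simp add: sum_distrib_left mult.assoc)
  also have "\<dots> \<le> C * real d * real N powr (1 - \<beta>) * (real A powr \<beta> / \<beta>)"
    using C \<beta> by (intro mult_left_mono sum_powr_le) auto
  also have "\<dots> \<le> C * real d * real N powr (1 - \<beta>) * ((real N powr \<alpha>) powr \<beta> / \<beta>)"
    using C \<beta> A_le by (intro mult_left_mono divide_right_mono powr_mono2) auto
  also have "\<dots> = C * (1 / \<beta>) * real d * (real N powr (1 - \<beta>) * real N powr (\<alpha> * \<beta>))"
    by (simp add: powr_powr)
  also have "\<dots> = C * (3 * real k / 2) * real d * real N powr \<gamma>"
    unfolding powr_add[symmetric] e1 by (simp add: \<beta>_def)
  finally have first: "norm (\<Sum>a=1..A. \<chi> a * tau_sum \<chi> k (N div a)) \<le>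
      C * (3 * real k / 2) * real d * real N powr \<gamma>" .

  \<comment> \<open>For \<open>b > N div A\<close> the inner interval is empty, so only
    \<open>b\<close> up to \<open>N div A\<close> matters. This truncation is what makes the trivial
    bound on the weights strong enough.\<close>
  have "norm (\<Sum>b=1..N. of_nat (divisor_tau k b) * \<chi> b * (\<Sum>a\<in>{A<..N div b}. \<chi> a)) =
      norm (\<Sum>b=1..N div A. of_nat (divisor_tau k b) * \<chi> b * (\<Sum>a\<in>{A<..N div b}. \<chi> a))"
  proof (rule arg_cong[of _ _ norm], rule sum.mono_neutral_right)
    show "\<forall>b\<in>{1..N} - {1..N div A}.
        of_nat (divisor_tau k b) * \<chi> b * (\<Sum>a\<in>{A<..N div b}. \<chi> a) = 0"
    proof
      fix b assume "b \<in> {1..N} - {1..N div A}"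
      then have "b \<ge> 1" "N div A < b"
        by auto
      then have "N < A * b"
        using A1 by (simp add: div_less_iff_less_mult mult.commute)
      then have "N div b < A"
        using \<open>b \<ge> 1\<close> by (simp add: div_less_iff_less_mult)
      then show "of_nat (divisor_tau k b) * \<chi> b * (\<Sum>a\<in>{A<..N div b}. \<chi> a) = 0"
        by simp
    qed
  qed (auto intro: order.trans[OF _ div_le_dividend])
  also have "\<dots> \<le> (\<Sum>b=1..N div A. real (divisor_tau k b) * 1 * (2 * real d))"
    unfolding norm_mult
    by (intro sum_norm_le, unfold norm_mult, intro mult_mono norm_dirichlet_character_le_1[OF \<chi>]
        norm_sum_dirichlet_character_interval[OF \<chi> np]) auto
  also have "\<dots> = 2 * real d * tau_sum (\<lambda>_. 1) k (N div A)"
    by (simp add: tau_sum_def sum_distrib_left mult_ac)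
  also have "\<dots> \<le> 2 * real d * (B * real (N div A) powr (1 + \<delta>))"
    using bound by (intro mult_left_mono) (auto simp: \<delta>_def)
  also have "\<dots> \<le> 2 * real d * (B * (4 * real N powr \<gamma>))"
  proof (intro mult_left_mono B)
    have "real (N div A) \<le> real N / real A"
      by (rule of_nat_div_le_of_nat)
    also have "\<dots> \<le> real N / (real N powr \<alpha> / 2)"
      using A_ge root A1 by (intro divide_left_mono) auto
    also have "\<dots> = 2 * real N powr (1 - \<alpha>)"
      using N by (simp add: powr_diff)
    finally have "real (N div A) powr (1 + \<delta>) \<le> (2 * real N powr (1 - \<alpha>)) powr (1 + \<delta>)"
      using \<delta> by (intro powr_mono2) auto
    also have "\<dots> = 2 powr (1 + \<delta>) * real N powr ((1 - \<alpha>) * (1 + \<delta>))"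
      by (simp add: powr_mult powr_powr)
    \<comment> \<open>As \<open>\<delta> \<le> 1\<close>, the rounding factor 2 contributes at most
      2^2 = 4.\<close>
    also have "\<dots> \<le> 2 powr 2 * real N powr \<gamma>"
      using \<delta> e2 N by (intro mult_mono powr_mono) auto
    finally show "real (N div A) powr (1 + \<delta>) \<le> 4 * real N powr \<gamma>"
      by simp
  qed auto
  finally have second:
    "norm (\<Sum>b=1..N. of_nat (divisor_tau k b) * \<chi> b * (\<Sum>a\<in>{A<..N div b}. \<chi> a)) \<le>
      8 * B * real d * real N powr \<gamma>"
    by (simp add: mult_ac)

  have "norm (tau_sum \<chi> (Suc k) N) \<le>
      C * (3 * real k / 2) * real d * real N powr \<gamma> + 8 * B * real d * real N powr \<gamma>"
    unfolding tau_sum_hyperbola[of \<chi>, OF mult AN]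
    by (rule norm_triangle_mono[OF first second])
  then show ?thesis
    by (simp add: \<gamma>_def algebra_simps)
qed

text \<open>The constant is quantified before \<open>d\<close>, \<open>\<chi>\<close> and
  \<open>N\<close>, so it depends on \<open>k\<close> alone. For \<open>k = 1\<close> the interval
  bound \<open>2 * real d\<close> already suffices, since the power of \<open>N\<close> is at least
  1.\<close>

lemma norm_tau_sum_character_le:
  assumes "k \<ge> 1"
  shows "\<exists>C\<ge>0. \<forall>d \<chi> N. dirichlet_character d \<chi> \<longrightarrow> \<chi> \<noteq> principal_character d \<longrightarrow> N \<ge> 1 \<longrightarrow>
      norm (tau_sum \<chi> k N) \<le> C * real d * real N powr (1 - 2 / (3 * real k))"
  using assms
proof (induction k rule: dec_induct)
  case base
  have "norm (tau_sum \<chi> 1 N) \<le> 2 * real d * real N powr (1 - 2 / (3 * real 1))"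
    if "dirichlet_character d \<chi>" "\<chi> \<noteq> principal_character d" "N \<ge> 1" for d \<chi> N
  proof -
    have "{1..N} = {0<..N}"
      by auto
    then have "norm (tau_sum \<chi> 1 N) \<le> 2 * real d * 1"
      unfolding tau_sum_1 using norm_sum_dirichlet_character_interval[OF that(1,2), of 0 N] by simp
    also have "\<dots> \<le> 2 * real d * real N powr (1 - 2 / (3 * real 1))"
      using that(3) by (intro mult_left_mono ge_one_powr_ge_zero) auto
    finally show ?thesis .
  qed
  then show ?case
    by (intro exI[of _ 2]) auto
next
  case (step k)
  then obtain C where C: "C \<ge> 0" "\<And>d \<chi> N. dirichlet_character d \<chi> \<Longrightarrow>
      \<chi> \<noteq> principal_character d \<Longrightarrow> N \<ge> 1 \<Longrightarrow>
      norm (tau_sum \<chi> k N) \<le> C * real d * real N powr (1 - 2 / (3 * real k))"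
    by blast
  \<comment> \<open>Chosen so that \<open>real k * \<beta>\<close> is the loss 1/(3(k+1)) that the
    induction step tolerates.\<close>
  define \<beta> where "\<beta> = 1 / (3 * (real k + 1)) / real k"
  define B where "B = (1 / \<beta>) ^ k"
  have "1 < 3 * (real k + 1) * real k"
    using step(1) mult_mono[of 1 "real k" 6 "3 * (real k + 1)"] by (simp add: mult.commute)
  then have \<beta>: "0 < \<beta>" "\<beta> < 1"
    using step(1) by (auto simp: \<beta>_def)
  have B: "B \<ge> 0"
    "\<And>N. tau_sum (\<lambda>_. 1 :: real) k N \<le> B * real N powr (1 + 1 / (3 * (real k + 1)))"
    using tau_sum_const_1_le_powr[OF \<beta>, of k] \<beta> step(1) by (auto simp: B_def \<beta>_def)
  have "norm (tau_sum \<chi> (Suc k) N) \<le>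
      (C * (3 * real k / 2) + 8 * B) * real d * real N powr (1 - 2 / (3 * real (Suc k)))"
    if "dirichlet_character d \<chi>" "\<chi> \<noteq> principal_character d" "N \<ge> 1" for d \<chi> N
    using norm_tau_sum_character_step[OF step(1) C(1) B(1) that(1,2) C(2)[OF that(1,2)] B(2) that(3)]
    by (simp add: add.commute)
  then show ?case
    using B(1) C(1) by (intro exI[of _ "C * (3 * real k / 2) + 8 * B"]) auto
qed

section \<open>Real cutoffs and the range of the modulus\<close>

theorem lemma3p3:
  fixes k :: nat
  assumes "k \<ge> 4"
  shows "\<exists>(C::real) (X0::real). \<forall>(X::real) (d::nat) (\<chi> :: nat \<Rightarrow> complex).
           X \<ge> X0 \<longrightarrow> 1 < d \<longrightarrow> real d < X powr (1 / (3 * (real k + 1))) \<longrightarrow>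
           primitive_character d \<chi> \<longrightarrow>
           norm (\<Sum>n | 1 \<le> n \<and> real n \<le> X. of_nat (divisor_tau k n) * \<chi> n)
             \<le> C * X powr (1 - 1 / (3 * (real k + 2)))"
proof -
  obtain C where C: "C \<ge> 0" "\<And>d \<chi> N. dirichlet_character d \<chi> \<Longrightarrow>
      \<chi> \<noteq> principal_character d \<Longrightarrow> N \<ge> 1 \<Longrightarrow>
      norm (tau_sum \<chi> k N) \<le> C * real d * real N powr (1 - 2 / (3 * real k))"
    using norm_tau_sum_character_le[of k] assms by auto
  \<comment> \<open>The threshold \<open>X0 = 1\<close> is enough: it only ensures that
    \<open>N \<ge> 1\<close> and that powers of \<open>X\<close> grow with the exponent.\<close>
  have "norm (\<Sum>n | 1 \<le> n \<and> real n \<le> X. of_nat (divisor_tau k n) * \<chi> n)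
             \<le> C * X powr (1 - 1 / (3 * (real k + 2)))"
    if X: "X \<ge> 1" and d: "1 < d" "real d < X powr (1 / (3 * (real k + 1)))"
      and prim: "primitive_character d \<chi>" for X d \<chi>
  proof -
    define N where "N = nat \<lfloor>X\<rfloor>"
    have N: "N \<ge> 1" "real N \<le> X"
      using X by (auto simp: N_def le_nat_iff)
    have "{n. 1 \<le> n \<and> real n \<le> X} = {1..N}"
      using X by (auto simp: N_def le_nat_iff le_floor_iff)
    then have "norm (\<Sum>n | 1 \<le> n \<and> real n \<le> X. of_nat (divisor_tau k n) * \<chi> n) =
        norm (tau_sum \<chi> k N)"
      by (simp add: tau_sum_def)
    also have "\<dots> \<le> C * real d * real N powr (1 - 2 / (3 * real k))"
      using prim primitive_character_nonprincipal[OF prim d(1)] N(1)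
      by (intro C(2)) (auto simp: primitive_character_def)
    \<comment> \<open>The assumed range turns the linear factor \<open>real d\<close> into a power
      of \<open>X\<close>.\<close>
    also have "\<dots> \<le> C * X powr (1 / (3 * (real k + 1))) * X powr (1 - 2 / (3 * real k))"
      using C(1) d N assms by (intro mult_mono powr_mono2) auto
    also have "\<dots> = C * X powr (1 / (3 * (real k + 1)) + (1 - 2 / (3 * real k)))"
      by (simp add: powr_add)
    also have "\<dots> \<le> C * X powr (1 - 1 / (3 * (real k + 2)))"
    proof (intro mult_left_mono powr_mono)
      \<comment> \<open>The saving 2/(3k) is split into two halves 1/(3k): one pays for
        \<open>d\<close>, the other covers the saving claimed.\<close>
      have "1 / (3 * (real k + 1)) \<le> 1 / (3 * real k)" "1 / (3 * (real k + 2)) \<le> 1 / (3 * real k)"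
        using assms by (auto intro!: divide_left_mono)
      then show "1 / (3 * (real k + 1)) + (1 - 2 / (3 * real k)) \<le> 1 - 1 / (3 * (real k + 2))"
        by simp
    qed (use X C in auto)
    finally show ?thesis .
  qed
  then show ?thesis
    by blast
qed

end
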